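(* Let $(V,P,\pi)$ be an irreducible and reversible Markov chain. For any $p \in (\frac12, 1]$, \[ \big(\varphi_p(P)\big)^2 \le \frac{4}{2p-1}\cdot \lambda_2(I-P). \]
   Context: A Markov chain $(V,P,\pi)$ consists of a finite state set $V$, a transition matrix $P$ (nonnegative entries, rows summing to $1$) and a stationary distribution $\pi$ ($\pi^T P = \pi^T$); irreducible means the transition graph is strongly connected, reversible means $\pi(u)P(u,v)=\pi(v)P(v,u)$ for all $u,v$. For a reversible chain $I-P$ has real eigenvalues and $\lambda_2(I-P)$ denotes the second smallest one. For $S\subseteq V$, $\pi(S)=\sum_{v\in S}\pi(v)$, $\overline S = V\setminus S$, $P(v,T)=\sum_{u\in T}P(v,u)$. For $p\in(0,1]$, \[ \varphi_p(P) = \min_{S \subset V,\ S\neq\emptyset,\ \pi(S)\le \frac12} \frac{\sum_{v\in S}\pi(v)\, P(v,\overline{S})^p}{\pi(S)}. \] *)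

theory Defs
  imports "HOL-Analysis.Analysis" "HOL-Computational_Algebra.Polynomial" "HOL-Library.Multiset"
begin

definition markov_chain :: "real^'v^'v \<Rightarrow> real^'v::finite \<Rightarrow> bool" where
  "markov_chain P \<pi> \<longleftrightarrow>
     (\<forall>u v. 0 \<le> P $ u $ v) \<and> (\<forall>u. (\<Sum>v\<in>UNIV. P $ u $ v) = 1) \<and>
     (\<forall>v. 0 \<le> \<pi> $ v) \<and> (\<Sum>v\<in>UNIV. \<pi> $ v) = 1 \<and>
     \<pi> v* P = \<pi>"

definition irreducible_chain :: "real^'v^'v::finite \<Rightarrow> bool" where
  "irreducible_chain P \<longleftrightarrow> (\<forall>u v. (u, v) \<in> {(x, y). 0 < P $ x $ y}\<^sup>*)"

definition reversible_chain :: "real^'v^'v \<Rightarrow> real^'v::finite \<Rightarrow> bool" where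
  "reversible_chain P \<pi> \<longleftrightarrow> (\<forall>u v. \<pi> $ u * P $ u $ v = \<pi> $ v * P $ v $ u)"

definition charpoly :: "real^'v^'v::finite \<Rightarrow> real poly" where
  "charpoly A = det (mat [:0, 1:] - (\<chi> i j. [:A $ i $ j:]))"

text \<open>
  The real eigenvalues in increasing order, each repeated according to its multiplicity as
  a root of the characteristic polynomial. The list has length \<open>CARD('v)\<close> precisely when
  all eigenvalues of the matrix are real.
\<close>
definition eigenvalues :: "real^'v^'v::finite \<Rightarrow> real list" where
  "eigenvalues A = sorted_list_of_multiset (proots (charpoly A))"

text \<open>List indices start at 0, so index 1 is the second smallest eigenvalue.\<close>
definition lambda2 :: "real^'v^'v::finite \<Rightarrow> real" where
  "lambda2 A = eigenvalues A ! 1"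

definition phi :: "real \<Rightarrow> real^'v^'v \<Rightarrow> real^'v::finite \<Rightarrow> real" where
  "phi p P \<pi> =
     Min ((\<lambda>S. (\<Sum>v\<in>S. \<pi> $ v * (\<Sum>u\<in>-S. P $ v $ u) powr p) / (\<Sum>v\<in>S. \<pi> $ v)) `
          {S. S \<noteq> {} \<and> (\<Sum>v\<in>S. \<pi> $ v) \<le> 1/2})"

end

theory Submission
  imports Defs
begin

text \<open>
  Let \<open>f\<close> be an eigenvector for \<open>\<lambda> = \<lambda>\<^sub>2(I - P)\<close>. It has \<open>\<pi>\<close>-mean zero, so up to sign its positive part
  \<open>g\<close> is supported on a set of measure at most \<open>1/2\<close>, and the energy of \<open>g\<close> is at most \<open>\<lambda> \<parallel>g\<parallel>\<^sup>2\<close>.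
  For a vertex \<open>v\<close> with \<open>a = g(v)\<close> put \<open>h(s) = P(v, {g \<le> s})\<close>. The contribution of \<open>v\<close> to the energy is
  \<open>\<integral> 2 (a - s) h(s) ds\<close> over \<open>[0, a]\<close>, while integrating the definition of \<open>\<phi>\<^sub>p\<close> over the level sets
  of \<open>g\<close> requires a bound on \<open>\<integral> 2 s h(s)\<^sup>p ds\<close>. The two are linked by the pointwise inequality
  \<open>k\<^sup>p \<le> p x k + \<psi>(x)\<close> for \<open>k \<in> [0, 1]\<close>, with \<open>\<psi>\<close> the smallest admissible function, used at
  \<open>x = (a - s) / (c a)\<close>. As \<open>\<integral> \<psi> = p / (2 (2 p - 1))\<close>, the choice \<open>c = sqrt ((2 p - 1) \<lambda>)\<close>
  gives \<open>\<phi>\<^sub>p\<^sup>2 \<le> 4 p\<^sup>2 \<lambda> / (2 p - 1)\<close>.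

  The index in \<open>lambda2\<close> makes it necessary to know that the characteristic polynomial of \<open>I - P\<close>
  has a simple root at \<open>0\<close> and at least one further real root; the latter is the minimum of the
  Rayleigh quotient on the vectors of mean zero.
\<close>

section \<open>Eigenvalues and the characteristic polynomial\<close>


lemma poly_charpoly: "poly (charpoly A) t = det (mat t - A)"
  by (simp add: charpoly_def det_def poly_sum poly_prod mat_def if_distrib[of "\<lambda>p. poly p t"]
      cong: if_cong)

lemma root_charpoly_iff:
  "poly (charpoly A) t = 0 \<longleftrightarrow> (\<exists>f. f \<noteq> 0 \<and> A *v f = t *\<^sub>R f)"
proof -
  have "poly (charpoly A) t = 0 \<longleftrightarrow> \<not> invertible (mat t - A)"
    by (simp add: poly_charpoly invertible_det_nz)
  also have "\<dots> \<longleftrightarrow> (\<exists>f. f \<noteq> 0 \<and> (mat t - A) *v f = 0)"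
    using matrix_left_invertible_ker[of "mat t - A"] invertible_left_inverse[of "mat t - A"] by auto
  also have "\<dots> \<longleftrightarrow> (\<exists>f. f \<noteq> 0 \<and> A *v f = t *\<^sub>R f)"
  proof -
    have "mat t *v f = t *\<^sub>R f" for f :: "real^'a"
      by (simp add: vec_eq_iff matrix_vector_mult_def mat_def if_distrib[of "\<lambda>x. x * _"] cong: if_cong)
    then show ?thesis by (auto simp: matrix_vector_mult_diff_rdistrib)
  qed
  finally show ?thesis .
qed

text \<open>Adding all other columns to column \<open>k\<close> of \<open>t I - A\<close> turns it into \<open>t\<close> times the
  all-ones column, because the rows of \<open>A\<close> sum to zero.\<close>
lemma charpoly_zero_row_sums:
  fixes A :: "real^'v^'v::finite"
  assumes rows: "A *v 1 = 0"
  shows "\<exists>q. charpoly A = [:0, 1:] * q \<and>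
             poly q 0 = det (\<chi> i j. if j = k then 1 else (- A) $ i $ j)"
proof -
  define M where "M t = (\<chi> i j. if j = k then 1 else (mat t - A) $ i $ j)" for t
  define q where "q = det (\<chi> i j. if j = k then 1 else (mat [:0, 1:] - (\<chi> i j. [:A $ i $ j:])) $ i $ j)"
  have pq: "poly q t = det (M t)" for t
    unfolding q_def M_def
    by (simp add: det_def poly_sum poly_prod mat_def if_distrib[of "\<lambda>p. poly p t"] cong: if_cong)
  have mt: "mat t *v 1 = (t *\<^sub>R 1 :: real^'v)" for t
    by (simp add: vec_eq_iff matrix_vector_mult_def mat_def cong: if_cong)
  have "det (mat t - A) = t * det (M t)" for t
  proof -
    have "det (mat t - A) = det (\<chi> i j. if j = k then ((mat t - A) *v 1) $ i else (mat t - A) $ i $ j)"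
      by (subst cramer_lemma) simp
    also have "(mat t - A) *v 1 = t *\<^sub>R 1"
      by (simp add: matrix_vector_mult_diff_rdistrib rows mt)
    \<comment> \<open>Column \<open>k\<close> of \<open>M t\<close> consists of ones, so
      \<open>M t\<close> sends \<open>axis k t\<close> to \<open>t\<close> times the all-ones
      vector; Cramer's lemma then extracts the factor \<open>t\<close>.\<close>
    also have "det (\<chi> i j. if j = k then (t *\<^sub>R 1) $ i else (mat t - A) $ i $ j)
        = det (\<chi> i j. if j = k then (M t *v (axis k t)) $ i else M t $ i $ j)"
      by (intro arg_cong[of _ _ det])
        (simp add: vec_eq_iff M_def
          matrix_vector_mult_def axis_def if_distrib[of "\<lambda>x. _ * x"] cong: if_cong)
    also have "\<dots> = t * det (M t)"
      by (subst cramer_lemma) (simp add: axis_def)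
    finally show ?thesis .
  qed
  then have "poly (charpoly A) = poly ([:0, 1:] * q)"
    by (simp add: fun_eq_iff poly_charpoly pq)
  then have "charpoly A = [:0, 1:] * q"
    using poly_eq_poly_eq_iff by blast
  moreover have "poly q 0 = det (\<chi> i j. if j = k then 1 else (- A) $ i $ j)"
    unfolding pq M_def by (intro arg_cong[of _ _ det]) (simp add: vec_eq_iff mat_def)
  ultimately show ?thesis by blast
qed

text \<open>Meant for the simple smallest root 0: a second copy of \<open>a\<close> at index 1 would
  contradict multiplicity one, and \<open>b\<close> guarantees that index 1 lies within the
  list.\<close>

lemma nth_Suc_0_sorted_list_of_multiset:
  fixes M :: "'a::linorder multiset"
  assumes min: "\<And>x. x \<in># M \<Longrightarrow> a \<le> x" and "count M a = 1" and "b \<in># M" "b \<noteq> a"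
  shows "sorted_list_of_multiset M ! 1 \<in># M \<and> a < sorted_list_of_multiset M ! 1"
proof -
  define xs where "xs = sorted_list_of_multiset M"
  have M: "M = mset xs" and sorted: "sorted xs" by (simp_all add: xs_def)
  have in_xs: "a \<in> set xs" "b \<in> set xs"
    using assms count_greater_zero_iff[of M a] by (simp_all add: M)
  then obtain x y zs where xs: "xs = x # y # zs"
    using \<open>b \<noteq> a\<close> by (cases xs; cases "tl xs") auto
  have "y \<in># M" by (simp add: M xs)
  have "y \<noteq> a"
  proof
    assume "y = a"
    then have "x = a" using sorted min[of x] by (simp add: M xs)
    then show False using \<open>y = a\<close> assms(2) by (simp add: M xs)
  qed
  then show ?thesis
    using min[OF \<open>y \<in># M\<close>] \<open>y \<in># M\<close> by (simp flip: xs_def add: xs)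
qed

section \<open>The pointwise inequality and its integrals\<close>

text \<open>The supremum of \<open>k\<^sup>p - p x k\<close> over \<open>k \<in> [0, 1]\<close>, attained at \<open>k = 1\<close> if \<open>x \<le> 1\<close> and at
  \<open>k = x powr (- 1 / (1 - p))\<close> otherwise. For \<open>p = 1\<close> the exponent is the junk value \<open>0\<close>, which is
  harmless because of the factor \<open>1 - p\<close>.\<close>
definition dual_profile :: "real \<Rightarrow> real \<Rightarrow> real" where
  "dual_profile p x = (if x \<le> 1 then 1 - p * x else (1 - p) * x powr (- (p / (1 - p))))"

lemma powr_le_dual_profile:
  assumes p: "0 < p" "p \<le> 1" and x: "0 < x" and k: "0 \<le> k" "k \<le> 1"
  shows "k powr p \<le> p * x * k + dual_profile p x"
proof (cases "k = 0")
  case True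
  \<comment> \<open>Since \<open>0 powr p\<close> is 0, only nonnegativity of the profile remains to
    be checked at \<open>k = 0\<close>.\<close>
  have "p * x \<le> 1" if "x \<le> 1" using p x that by (simp add: mult_le_one)
  then show ?thesis using True p by (simp add: dual_profile_def)
next
  case False
  then have k: "0 < k" "k \<le> 1" using k by auto
  consider "x \<le> 1" | "1 < x" "p = 1" | "1 < x" "p < 1" using p by linarith
  then show ?thesis
  proof cases
    case 1
    have "k powr p \<le> p * k + (1 - p)"
      using Youngs_inequality_0[of p "1 - p" k 1] p k by simp
    \<comment> \<open>This product is exactly the slack between the tangent bound at
      \<open>k = 1\<close> above and the claim.\<close>
    moreover have "0 \<le> p * ((1 - k) * (1 - x))" using p k 1 by simp
    ultimately show ?thesis using 1 by (simp add: dual_profile_def algebra_simps)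
  next
    case 2
    then show ?thesis using k mult_right_mono[of 1 x k] by (simp add: dual_profile_def)
  next
    case 3
    \<comment> \<open>Chosen so that \<open>y powr (1 - p)\<close> cancels the factor
      \<open>x powr p\<close> on the left of Young's inequality.\<close>
    define y where "y = x powr (- (p / (1 - p)))"
    have "y powr (1 - p) = x powr (- p)" using 3 by (simp add: y_def powr_powr)
    then have "(x * k) powr p * y powr (1 - p) = k powr p"
      using x k by (simp add: powr_mult powr_minus)
    moreover have "(x * k) powr p * y powr (1 - p) \<le> p * (x * k) + (1 - p) * y"
      using p x k by (intro Youngs_inequality_0) (auto simp: y_def)
    ultimately show ?thesis using 3 by (simp add: dual_profile_def y_def mult.assoc)
  qed
qed

lemma has_integral_interval_indicator:
  fixes F :: "real \<Rightarrow> real"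
  assumes "0 \<le> b" "b \<le> a" "a \<le> M"
    and deriv: "\<And>s. s \<in> {b..a} \<Longrightarrow> (F has_real_derivative f s) (at s within {b..a})"
  shows "((\<lambda>s. if b \<le> s \<and> s < a then f s else 0) has_integral F a - F b) {0..M}"
proof (rule has_integral_spike_finite[of "{a}"])
  show "((\<lambda>s. if s \<in> {b..a} then f s else 0) has_integral F a - F b) {0..M}"
    using assms
    by (subst has_integral_restrict)
      (auto intro!: fundamental_theorem_of_calculus simp flip: has_real_derivative_iff_has_vector_derivative)
qed auto

text \<open>Layer-cake formula for squares: with \<open>a = g(v)\<close> it turns the squared norm
  of \<open>g\<close> into an integral over the measures of its level sets.\<close>

lemma has_integral_level_weight:
  fixes a M :: real
  assumes "0 \<le> a" "a \<le> M"
  shows "((\<lambda>s. if s < a then 2 * s else 0) has_integral a\<^sup>2) {0..M}"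
\<comment> \<open>The exceptional set is empty because \<open>0 \<le> s\<close> holds throughout the
  domain, so the two integrands agree there.\<close>
proof (rule has_integral_spike_finite[of "{}"])
  show "((\<lambda>s. if 0 \<le> s \<and> s < a then 2 * s else 0) has_integral a\<^sup>2) {0..M}"
    using has_integral_interval_indicator[of 0 a M "\<lambda>s. s\<^sup>2" "\<lambda>s. 2 * s"] assms
    by (force intro!: derivative_eq_intros)
qed auto

text \<open>For \<open>a = g(v)\<close> and \<open>b = g(u)\<close> the integrand lives on the
  levels that separate \<open>u\<close> from \<open>v\<close>, and its integral is the factor of
  that edge in \<open>energy\<close>.\<close>

lemma has_integral_gap:
  fixes a b :: real
  assumes "0 \<le> b" "a \<le> M"
  shows "((\<lambda>s. if b \<le> s \<and> s < a then 2 * (a - s) else 0) has_integral (max 0 (a - b))\<^sup>2) {0..M}"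
proof (cases "b \<le> a")
  case True
  then show ?thesis
    using has_integral_interval_indicator[of b a M "\<lambda>s. - ((a - s)\<^sup>2)" "\<lambda>s. 2 * (a - s)"] assms
    by (force intro!: derivative_eq_intros simp: max_def)
next
  case False
  then have "(\<lambda>s. if b \<le> s \<and> s < a then 2 * (a - s) else 0) = (\<lambda>s. 0)" by auto
  then show ?thesis using False by (simp add: max_def)
qed

text \<open>Substituting \<open>x = (a - s) / (c * a)\<close> gives \<open>2 * a\<^sup>2 * c\<close>
  times the integral of the profile over \<open>[0, 1/c]\<close>. Extending the range to infinity
  yields the bound; the tail converges because \<open>p > 1/2\<close> makes
  \<open>p / (1 - p)\<close> exceed 1 when \<open>p < 1\<close>.\<close>

lemma has_integral_dual_profile:
  assumes p: "1/2 < p" "p \<le> 1" and c: "0 < c" "c \<le> 1" and a: "0 \<le> a" "a \<le> M"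
  shows "\<exists>I. ((\<lambda>s. if s < a then 2 * a * dual_profile p ((a - s) / (c * a)) else 0) has_integral I) {0..M}
           \<and> I \<le> a\<^sup>2 * (c * p / (2 * p - 1))"
proof (cases "a = 0")
  case True
  then show ?thesis by (intro exI[of _ 0]) (auto simp: if_distrib cong: if_cong)
next
  case False
  then have a: "0 < a" "a \<le> M" using a by auto
  \<comment> \<open>At \<open>s = d\<close> the argument of the profile equals 1, so its branch
    changes there; \<open>c \<le> 1\<close> places \<open>d\<close> in the domain.\<close>
  define d where "d = a - c * a"
  have d: "0 \<le> d" "d \<le> a" "d \<le> M" "d < a" using a c by (auto simp: d_def intro: order_trans[of _ a])
  \<comment> \<open>\<open>F1\<close> and \<open>F2\<close> are antiderivatives for the power branch
    and the affine branch. For \<open>p = 1\<close> the factors \<open>1 - p\<close> make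
    \<open>F1\<close> and \<open>f1\<close> vanish, whatever the exponents are.\<close>
  define F1 where "F1 s = 2 * a * ((1 - p)\<^sup>2 / (2 * p - 1) * (c * a)) * ((a - s) / (c * a)) powr (- ((2 * p - 1) / (1 - p)))" for s
  define f1 where "f1 s = 2 * a * ((1 - p) * ((a - s) / (c * a)) powr (- (p / (1 - p))))" for s
  define F2 where "F2 s = 2 * a * (s + p * (a - s)\<^sup>2 / (2 * c * a))" for s
  define f2 where "f2 s = 2 * a * (1 - p * ((a - s) / (c * a)))" for s
  have 1: "((\<lambda>s. if 0 \<le> s \<and> s < d then f1 s else 0) has_integral F1 d - F1 0) {0..M}"
  proof (rule has_integral_interval_indicator)
    fix s assume "s \<in> {0..d}"
    then have s: "0 < (a - s) / (c * a)" using d a c by (auto intro!: divide_pos_pos)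
    show "(F1 has_real_derivative f1 s) (at s within {0..d})"
    proof (cases "p = 1")
      case True
      then show ?thesis by (simp add: F1_def[abs_def] f1_def)
    next
      case False
      have e: "- ((2 * p - 1) / (1 - p)) - 1 = - (p / (1 - p))" using False by (simp add: field_simps)
      have k: "2 * a * ((1 - p)\<^sup>2 / (2 * p - 1) * (c * a)) * (- ((2 * p - 1) / (1 - p)) * X * (- 1 / (c * a)))
          = 2 * a * ((1 - p) * X)" for X
        using False p a c by (simp add: divide_simps power2_eq_square)
      have "((\<lambda>s. ((a - s) / (c * a)) powr (- ((2 * p - 1) / (1 - p)))) has_real_derivative
          - ((2 * p - 1) / (1 - p)) * ((a - s) / (c * a)) powr (- ((2 * p - 1) / (1 - p)) - 1) * (- 1 / (c * a)))
          (at s within {0..d})"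
        by (rule DERIV_chain2[where g = "\<lambda>s. (a - s) / (c * a)", OF has_real_derivative_powr])
          (use s a c in \<open>auto intro!: derivative_eq_intros\<close>)
      from DERIV_cmult[OF this, of "2 * a * ((1 - p)\<^sup>2 / (2 * p - 1) * (c * a))"]
      show ?thesis unfolding k e F1_def[abs_def] f1_def .
    qed
  qed (use d in auto)
  have 2: "((\<lambda>s. if d \<le> s \<and> s < a then f2 s else 0) has_integral F2 a - F2 d) {0..M}"
  proof (rule has_integral_interval_indicator)
    fix s assume "s \<in> {d..a}"
    show "(F2 has_real_derivative f2 s) (at s within {d..a})"
      unfolding F2_def f2_def using a c by (auto intro!: derivative_eq_intros simp: field_simps)
  qed (use d a in auto)
  have eq: "(if s < a then 2 * a * dual_profile p ((a - s) / (c * a)) else 0)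
      = (if 0 \<le> s \<and> s < d then f1 s else 0) + (if d \<le> s \<and> s < a then f2 s else 0)"
    if "s \<in> {0..M}" for s
  proof -
    have "(a - s) / (c * a) \<le> 1 \<longleftrightarrow> d \<le> s" using a c by (auto simp: d_def field_simps)
    then show ?thesis using that d by (auto simp: dual_profile_def f1_def f2_def)
  qed
  have "((\<lambda>s. if s < a then 2 * a * dual_profile p ((a - s) / (c * a)) else 0)
      has_integral (F1 d - F1 0) + (F2 a - F2 d)) {0..M}"
    by (rule has_integral_eq[OF _ has_integral_add[OF 1 2]]) (rule eq[symmetric])
  moreover have "(F1 d - F1 0) + (F2 a - F2 d) \<le> a\<^sup>2 * (c * p / (2 * p - 1))"
  proof -
    have "F1 d = 2 * a\<^sup>2 * c * ((1 - p)\<^sup>2 / (2 * p - 1))"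
      using a c by (simp add: F1_def d_def power2_eq_square)
    \<comment> \<open>\<open>F1 0\<close> is the contribution of the tail \<open>x > 1/c\<close>,
      which is discarded.\<close>
    moreover have "0 \<le> F1 0" unfolding F1_def using a c p by simp
    moreover have "F2 a - F2 d = 2 * a\<^sup>2 * c * (1 - p / 2)"
      using a c by (simp add: F2_def d_def field_simps power2_eq_square)
    moreover have "2 * a\<^sup>2 * c * ((1 - p)\<^sup>2 / (2 * p - 1)) + 2 * a\<^sup>2 * c * (1 - p / 2)
        = a\<^sup>2 * (c * p / (2 * p - 1))"
      using p by (simp add: field_simps power2_eq_square)
    ultimately show ?thesis by linarith
  qed
  ultimately show ?thesis by blast
qed

section \<open>Reversible chains\<close>

text \<open>Adding to each side its copy with \<open>u\<close> and \<open>v\<close> exchanged gives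
  the weighted sum of \<open>(g v - g u)\<^sup>2\<close> in both cases. The positive part charges
  each edge to its higher endpoint, as the level sets do.\<close>

lemma symmetric_weight_energy:
  fixes w :: "'v::finite \<Rightarrow> 'v \<Rightarrow> real" and g :: "'v \<Rightarrow> real"
  assumes sym: "\<And>u v. w u v = w v u"
  shows "(\<Sum>v\<in>UNIV. \<Sum>u\<in>UNIV. w v u * (g v * (g v - g u)))
       = (\<Sum>v\<in>UNIV. \<Sum>u\<in>UNIV. w v u * (max 0 (g v - g u))\<^sup>2)"
proof -
  let ?A = "\<Sum>v\<in>UNIV. \<Sum>u\<in>UNIV. w v u * (g v * (g v - g u))"
  let ?B = "\<Sum>v\<in>UNIV. \<Sum>u\<in>UNIV. w v u * (max 0 (g v - g u))\<^sup>2"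
  have a: "?A = (\<Sum>v\<in>UNIV. \<Sum>u\<in>UNIV. w v u * (g u * (g u - g v)))"
    by (subst sum.swap) (simp add: sym)
  have b: "?B = (\<Sum>v\<in>UNIV. \<Sum>u\<in>UNIV. w v u * (max 0 (g u - g v))\<^sup>2)"
    by (subst sum.swap) (simp add: sym)
  have pt: "w v u * (g v * (g v - g u)) + w v u * (g u * (g u - g v))
      = w v u * (max 0 (g v - g u))\<^sup>2 + w v u * (max 0 (g u - g v))\<^sup>2" for u v
    by (cases "g u \<le> g v") (simp_all add: max_def algebra_simps power2_eq_square)
  have "?A + ?A = (\<Sum>v\<in>UNIV. \<Sum>u\<in>UNIV.
      w v u * (g v * (g v - g u)) + w v u * (g u * (g u - g v)))"
    by (subst (2) a) (simp only: sum.distrib)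
  also have "\<dots> = (\<Sum>v\<in>UNIV. \<Sum>u\<in>UNIV.
      w v u * (max 0 (g v - g u))\<^sup>2 + w v u * (max 0 (g u - g v))\<^sup>2)"
    by (simp only: pt)
  also have "\<dots> = ?B + ?B"
    by (subst (2) b) (simp only: sum.distrib)
  finally show ?thesis by simp
qed

locale reversible_markov =
  fixes P :: "real^'v^'v::finite" and \<pi> :: "real^'v"
  assumes chain: "markov_chain P \<pi>" and irreducible: "irreducible_chain P"
    and reversible: "reversible_chain P \<pi>"
begin

lemma P_nonneg: "0 \<le> P $ u $ v"
  and row_sum: "(\<Sum>v\<in>UNIV. P $ u $ v) = 1"
  and \<pi>_sum: "(\<Sum>v\<in>UNIV. \<pi> $ v) = 1"
  using chain by (simp_all add: markov_chain_def)

lemma detailed_balance: "\<pi> $ u * P $ u $ v = \<pi> $ v * P $ v $ u"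
  using reversible by (simp add: reversible_chain_def)

lemma path_induct:
  assumes "Q u" and "\<And>x y. 0 < P $ x $ y \<Longrightarrow> Q x \<Longrightarrow> Q y"
  shows "Q v"
proof -
  have "(u, v) \<in> {(x, y). 0 < P $ x $ y}\<^sup>*"
    using irreducible by (simp add: irreducible_chain_def)
  then show ?thesis by (induction rule: rtrancl_induct) (use assms in auto)
qed

lemma \<pi>_pos: "0 < \<pi> $ v"
proof -
  have nn: "0 \<le> \<pi> $ u" for u using chain by (simp add: markov_chain_def)
  obtain u where u: "\<pi> $ u \<noteq> 0" using \<pi>_sum by (metis sum.neutral zero_neq_one)
  show ?thesis
  proof (rule path_induct)
    show "0 < \<pi> $ u" using nn[of u] u by simp
    fix x y assume "0 < P $ x $ y" "0 < \<pi> $ x"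
    then have "0 < \<pi> $ y * P $ y $ x" by (simp flip: detailed_balance)
    then show "0 < \<pi> $ y" using nn[of y] P_nonneg[of y x] by (simp add: zero_less_mult_iff)
  qed
qed

section \<open>The Laplacian and the \<pi>-weighted inner product\<close>

definition L :: "real^'v^'v" where "L = mat 1 - P"

lemma L_nth: "(L *v f) $ v = (\<Sum>u\<in>UNIV. P $ v $ u * (f $ v - f $ u))"
  by (simp add: L_def matrix_vector_mult_diff_rdistrib matrix_vector_mult_def[of P]
      right_diff_distrib sum_subtractf row_sum flip: sum_distrib_right)

lemma L_one: "L *v 1 = 0"
  by (simp add: vec_eq_iff L_nth)

definition ip :: "real^'v \<Rightarrow> real^'v \<Rightarrow> real" where
  "ip f g = (\<Sum>v\<in>UNIV. \<pi> $ v * (f $ v * g $ v))"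

lemma ip_simps:
  "ip (f + g) h = ip f h + ip g h" "ip h (f + g) = ip h f + ip h g"
  "ip (f - g) h = ip f h - ip g h" "ip h (f - g) = ip h f - ip h g"
  "ip (c *\<^sub>R f) h = c * ip f h" "ip h (c *\<^sub>R f) = c * ip h f"
  "ip 0 h = 0" "ip h 0 = 0"
  by (simp_all add: ip_def algebra_simps sum.distrib sum_subtractf sum_distrib_left)

lemma ip_commute: "ip f g = ip g f"
  by (simp add: ip_def mult.commute)

lemma ip_nonneg: "0 \<le> ip f f"
  unfolding ip_def by (intro sum_nonneg) (simp add: less_imp_le[OF \<pi>_pos])

lemma ip_eq_0_iff: "ip f f = 0 \<longleftrightarrow> f = 0"
proof
  assume "ip f f = 0"
  then have "\<forall>v. \<pi> $ v * (f $ v * f $ v) = 0"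
    unfolding ip_def
    by (subst (asm) sum_nonneg_eq_0_iff) (simp_all add: less_imp_le[OF \<pi>_pos])
  then have "f $ v = 0" for v
    using \<pi>_pos[of v] by (metis less_irrefl mult_eq_0_iff)
  then show "f = 0" by (simp add: vec_eq_iff)
qed (simp add: ip_simps)

lemma ip_L: "ip f (L *v g) = (\<Sum>v\<in>UNIV. \<Sum>u\<in>UNIV. \<pi> $ v * P $ v $ u * (f $ v * (g $ v - g $ u)))"
  by (simp add: ip_def L_nth sum_distrib_left mult_ac)

lemma L_self_adjoint: "ip f (L *v g) = ip (L *v f) g"
proof -
  have "(\<Sum>v\<in>UNIV. \<Sum>u\<in>UNIV. \<pi> $ v * P $ v $ u * (f $ v * g $ u))
      = (\<Sum>v\<in>UNIV. \<Sum>u\<in>UNIV. \<pi> $ v * P $ v $ u * (g $ v * f $ u))"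
    by (subst sum.swap) (simp add: detailed_balance mult_ac)
  then show ?thesis
    unfolding ip_commute[of "L *v f"] ip_L by (simp add: algebra_simps sum_subtractf)
qed

lemma energy:
  "ip g (L *v g) = (\<Sum>v\<in>UNIV. \<Sum>u\<in>UNIV. \<pi> $ v * P $ v $ u * (max 0 (g $ v - g $ u))\<^sup>2)"
  unfolding ip_L by (rule symmetric_weight_energy) (rule detailed_balance)

lemma energy_nonneg: "0 \<le> ip g (L *v g)"
  unfolding energy
  by (intro sum_nonneg mult_nonneg_nonneg less_imp_le[OF \<pi>_pos] P_nonneg) simp

text \<open>Zero energy forbids a decrease of \<open>f\<close> along any edge. Irreducibility gives
  paths from \<open>u\<close> to \<open>v\<close> and back, so neither value exceeds the
  other.\<close>

lemma harmonic_const: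
  assumes "L *v f = 0"
  shows "f $ u = f $ v"
proof -
  have "(\<Sum>v\<in>UNIV. \<Sum>u\<in>UNIV. \<pi> $ v * P $ v $ u * (max 0 (f $ v - f $ u))\<^sup>2) = 0"
    using assms by (simp flip: energy add: ip_simps)
  then have "\<forall>x y. \<pi> $ x * P $ x $ y * (max 0 (f $ x - f $ y))\<^sup>2 = 0"
    by (simp add: sum_nonneg_eq_0_iff sum_nonneg less_imp_le[OF \<pi>_pos] P_nonneg)
  then have le: "f $ x \<le> f $ y" if "0 < P $ x $ y" for x y
    using that \<pi>_pos[of x]
    by (metis diff_gt_0_iff_gt less_irrefl max.absorb4 mult_eq_0_iff not_le power_eq_0_iff)
  have "f $ u \<le> f $ v" for u v
    by (rule path_induct[where Q = "\<lambda>v. f $ u \<le> f $ v"]) (use le in force)+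
  then show ?thesis by (simp add: antisym)
qed

section \<open>The spectrum of \<open>L\<close>\<close>

lemma eigenvalue_nonneg:
  assumes "f \<noteq> 0" "L *v f = \<mu> *\<^sub>R f"
  shows "0 \<le> \<mu>"
  using energy_nonneg[of f] assms ip_nonneg[of f] ip_eq_0_iff[of f]
  by (simp add: ip_simps zero_le_mult_iff)

lemma ip_one_L: "ip 1 (L *v f) = 0"
  by (simp add: L_self_adjoint L_one ip_simps)

text \<open>By \<open>charpoly_zero_row_sums\<close>, simplicity of the root 0 amounts to
  invertibility of \<open>M\<close>, whose kernel is shown to be trivial.\<close>

lemma charpoly_L_order_0: "charpoly L \<noteq> 0 \<and> order 0 (charpoly L) = 1"
proof -
  fix k :: 'v
  define M :: "real^'v^'v" where "M = (\<chi> i j. if j = k then 1 else (- L) $ i $ j)"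
  obtain q where q: "charpoly L = [:0, 1:] * q" and q0: "poly q 0 = det M"
    unfolding M_def using charpoly_zero_row_sums[OF L_one] by blast
  have "x = 0" if "M *v x = 0" for x
  proof -
    define y where "y = (\<chi> j. if j = k then 0 else x $ j)"
    have "M *v x = x $ k *\<^sub>R 1 - L *v y"
    proof -
      have "(M *v x) $ i = x $ k - (L *v y) $ i" for i
      proof -
        have "(M *v x) $ i = (\<Sum>j\<in>UNIV. (if j = k then x $ k else 0) - L $ i $ j * y $ j)"
          unfolding matrix_vector_mult_def M_def y_def by (auto intro!: sum.cong)
        then show ?thesis by (simp add: sum_subtractf matrix_vector_mult_def)
      qed
      then show ?thesis by (simp add: vec_eq_iff)
    qed
    then have Ly: "L *v y = x $ k *\<^sub>R 1" using that by simp
    \<comment> \<open>Pairing with the constant vector annihilates \<open>L *v y\<close>. Once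
      \<open>x $ k = 0\<close>, the vector \<open>y\<close> is harmonic, hence constant and equal to
      its entry 0 at \<open>k\<close>.\<close>
    then have "x $ k * ip 1 1 = 0" using ip_one_L[of y] by (simp add: ip_simps)
    then have xk: "x $ k = 0" by (simp add: ip_def \<pi>_sum)
    then have "y $ j = y $ k" for j using Ly harmonic_const by simp
    then show "x = 0" using xk by (simp add: y_def vec_eq_iff split: if_splits) metis
  qed
  then have "invertible M"
    using matrix_left_invertible_ker[of M] invertible_left_inverse[of M] by blast
  then have "poly q 0 \<noteq> 0" by (simp add: q0 invertible_det_nz)
  then have "q \<noteq> 0" and "order 0 q = 0" by (auto intro: order_0I)
  then have "order 0 (charpoly L) = order 0 [:0, 1::real:] + 0"
    unfolding q by (subst order_mult) (auto simp del: mult_pCons_left)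
  also have "order 0 [:0, 1::real:] = 1"
    using order_power_n_n[of "0::real" 1] by simp
  finally show ?thesis using \<open>q \<noteq> 0\<close> by (auto simp: q)
qed

text \<open>The unit sphere of the mean-zero subspace is compact, so the energy attains its infimum
  there; scaling carries the bound to every mean-zero vector.\<close>

lemma Rayleigh_minimizer:
  assumes "CARD('v) \<ge> 2"
  shows "\<exists>f. ip f f = 1 \<and> ip 1 f = 0 \<and> (\<forall>h. ip 1 h = 0 \<longrightarrow> ip f (L *v f) * ip h h \<le> ip h (L *v h))"
proof -
  define K where "K = {f. ip f f = 1 \<and> ip 1 f = 0}"
  have cont: "continuous_on UNIV (\<lambda>f. ip f f)" "continuous_on UNIV (ip 1)"
    "continuous_on UNIV (\<lambda>f. ip f (L *v f))"
    unfolding ip_def L_nth by (intro continuous_intros)+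
  have normalize: "(1 / sqrt (ip h h)) *\<^sub>R h \<in> K" if "h \<noteq> 0" "ip 1 h = 0" for h
    using that ip_nonneg[of h] ip_eq_0_iff[of h] by (simp add: K_def ip_simps field_simps)
  obtain a b :: 'v where "a \<noteq> b"
    using assms by (metis (mono_tags) UNIV_I card_2_iff' ex_card)
  \<comment> \<open>A mean-zero vector supported on two states, which shows that \<open>K\<close> is
    nonempty.\<close>
  define h0 where "h0 = axis a (\<pi> $ b) - axis b (\<pi> $ a)"
  have "h0 $ a \<noteq> 0" using \<open>a \<noteq> b\<close> \<pi>_pos[of b] by (simp add: h0_def axis_def)
  then have "h0 \<noteq> 0" by auto
  moreover have "ip 1 h0 = 0"
    by (simp add: h0_def ip_simps) (simp add: ip_def axis_def if_distrib[of "\<lambda>x. _ * x"] cong: if_cong)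
  ultimately have "K \<noteq> {}" using normalize by blast
  moreover have "compact K"
  proof (rule compact_eq_bounded_closed[THEN iffD2], intro conjI)
    have "norm f \<le> (\<Sum>v\<in>UNIV. 1 / \<pi> $ v)" if "f \<in> K" for f
    proof -
      have "\<bar>f $ v\<bar> \<le> 1 / \<pi> $ v" for v
      proof -
        have "\<pi> $ v * (f $ v * f $ v) \<le> ip f f"
          unfolding ip_def by (rule member_le_sum) (simp_all add: less_imp_le[OF \<pi>_pos])
        also have "\<dots> = 1" using that by (simp add: K_def)
        finally have 1: "\<pi> $ v * (f $ v * f $ v) \<le> 1" .
        have "\<pi> $ v \<le> 1"
          unfolding \<pi>_sum[symmetric] by (rule member_le_sum) (auto intro!: less_imp_le[OF \<pi>_pos])
        \<comment> \<open>The additional factor \<open>\<pi> $ v \<le> 1\<close> creates a perfect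
          square and gives a bound without square roots.\<close>
        then have "\<pi> $ v * (\<pi> $ v * (f $ v * f $ v)) \<le> 1 * 1"
          using \<pi>_pos[of v] 1 by (intro mult_mono) auto
        then have "(\<pi> $ v * f $ v)\<^sup>2 \<le> 1" by (simp add: power2_eq_square mult_ac)
        then have "\<bar>\<pi> $ v * f $ v\<bar> \<le> 1" by (simp add: abs_square_le_1)
        then show ?thesis using \<pi>_pos[of v] by (simp add: abs_mult field_simps)
      qed
      then show ?thesis by (rule order_trans[OF norm_le_l1_cart sum_mono])
    qed
    then show "bounded K" by (auto simp: bounded_iff)
    have "K = {f. ip f f = 1} \<inter> {f. ip 1 f = 0}" by (auto simp: K_def)
    then show "closed K" using cont(1,2)
      by (auto intro!: closed_Collect_eq closed_Int continuous_intros)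
  qed
  ultimately obtain f where "f \<in> K" and min: "\<And>h. h \<in> K \<Longrightarrow> ip f (L *v f) \<le> ip h (L *v h)"
    using continuous_attains_inf[of K "\<lambda>f. ip f (L *v f)"] cont(3) continuous_on_subset by blast
  have "ip f (L *v f) * ip h h \<le> ip h (L *v h)" if "ip 1 h = 0" for h
  proof (cases "h = 0")
    case False
    have "0 < ip h h" using False ip_nonneg[of h] ip_eq_0_iff[of h] by linarith
    then show ?thesis
      using min[OF normalize[OF False that]]
      by (simp add: matrix_vector_mult_scaleR ip_simps field_simps)
  qed (simp add: ip_simps)
  then show ?thesis using \<open>f \<in> K\<close> by (auto simp: K_def)
qed

text \<open>First variation at the minimizer: taking the residual \<open>g\<close> itself as
  direction makes the linear coefficient a multiple of \<open>ip g g\<close>, which minimality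
  forces to vanish.\<close>

lemma ex_nonzero_eigenvalue:
  assumes "CARD('v) \<ge> 2"
  shows "\<exists>\<mu> f. \<mu> \<noteq> 0 \<and> f \<noteq> 0 \<and> L *v f = \<mu> *\<^sub>R f"
proof -
  obtain f where f: "ip f f = 1" "ip 1 f = 0"
    and min: "\<And>h. ip 1 h = 0 \<Longrightarrow> ip f (L *v f) * ip h h \<le> ip h (L *v h)"
    using Rayleigh_minimizer[OF assms] by blast
  define \<mu> where "\<mu> = ip f (L *v f)"
  define g where "g = L *v f - \<mu> *\<^sub>R f"
  define C where "C = ip g (L *v g) - \<mu> * ip g g"
  have g1: "ip 1 g = 0" by (simp add: g_def ip_simps f ip_one_L)
  have var: "0 \<le> 2 * s * ip g g + s\<^sup>2 * C" for s
  proof -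
    have "0 \<le> ip (f + s *\<^sub>R g) (L *v (f + s *\<^sub>R g)) - \<mu> * ip (f + s *\<^sub>R g) (f + s *\<^sub>R g)"
      using min[of "f + s *\<^sub>R g"] by (simp add: ip_simps f g1 \<mu>_def)
    also have "\<dots> = 2 * s * (ip g (L *v f) - \<mu> * ip g f) + s\<^sup>2 * C"
      using L_self_adjoint[of f g] ip_commute[of f g] ip_commute[of "L *v f" g]
      by (simp add: matrix_vector_right_distrib matrix_vector_mult_scaleR ip_simps f C_def
          \<mu>_def[symmetric] power2_eq_square algebra_simps)
    also have "ip g (L *v f) - \<mu> * ip g f = ip g g"
      by (simp add: g_def ip_simps)
    finally show ?thesis .
  qed
  have "ip g g = 0"
  proof (rule ccontr)
    assume "ip g g \<noteq> 0"
    then have pos: "0 < ip g g" using ip_nonneg[of g] by simp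
    \<comment> \<open>Small enough for \<open>s * C \<le> ip g g\<close>; at \<open>- s\<close> the
      linear term then outweighs the quadratic one, against \<open>var\<close>.\<close>
    define s where "s = ip g g / (\<bar>C\<bar> + 1)"
    have "0 < s" using pos by (simp add: s_def divide_pos_pos)
    have "s * C \<le> s * (\<bar>C\<bar> + 1)" using \<open>0 < s\<close> by (intro mult_left_mono) auto
    also have "\<dots> = ip g g" by (simp add: s_def)
    finally have "s * (s * C) \<le> s * ip g g" using \<open>0 < s\<close> by simp
    moreover have "2 * (s * ip g g) \<le> s * (s * C)"
      using var[of "- s"] by (simp add: power2_eq_square algebra_simps)
    moreover have "0 < s * ip g g" using \<open>0 < s\<close> pos by simp
    ultimately show False by linarith
  qed
  then have eig: "L *v f = \<mu> *\<^sub>R f" by (simp add: ip_eq_0_iff g_def)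
  have "f \<noteq> 0" using f by (auto simp: ip_simps)
  moreover have "\<mu> \<noteq> 0"
  proof
    fix k :: 'v
    assume "\<mu> = 0"
    then have "f $ v = f $ k" for v using harmonic_const eig by simp
    then have "f = (f $ k) *\<^sub>R 1" by (simp add: vec_eq_iff)
    then have "f $ k * ip 1 1 = 0" using f(2) by (metis ip_simps(6))
    then have "f $ k = 0" by (simp add: ip_def \<pi>_sum)
    then show False using \<open>f = (f $ k) *\<^sub>R 1\<close> \<open>f \<noteq> 0\<close> by simp
  qed
  ultimately show ?thesis using eig by blast
qed

text \<open>0 is the smallest root and simple, and a further root exists, so index 1 of the sorted
  list is a positive root.\<close>

lemma lambda2_eigenvector:
  assumes "CARD('v) \<ge> 2"
  shows "0 < lambda2 L \<and> (\<exists>f. f \<noteq> 0 \<and> L *v f = lambda2 L *\<^sub>R f)"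
proof -
  note ch = charpoly_L_order_0
  obtain \<mu> f where "\<mu> \<noteq> 0" "f \<noteq> 0" "L *v f = \<mu> *\<^sub>R f"
    using ex_nonzero_eigenvalue[OF assms] by blast
  then have "poly (charpoly L) \<mu> = 0" by (auto simp: root_charpoly_iff)
  then have "lambda2 L \<in># proots (charpoly L) \<and> 0 < lambda2 L"
    unfolding lambda2_def eigenvalues_def
    using ch \<open>\<mu> \<noteq> 0\<close> eigenvalue_nonneg
    by (intro nth_Suc_0_sorted_list_of_multiset[where b = \<mu>]) (auto simp: root_charpoly_iff)
  then show ?thesis using ch by (simp add: root_charpoly_iff)
qed

section \<open>Bounds on \<open>phi\<close> and integration over level sets\<close>

lemma phi_mult_le:
  assumes "S \<noteq> {}" "(\<Sum>v\<in>S. \<pi> $ v) \<le> 1/2"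
  shows "phi p P \<pi> * (\<Sum>v\<in>S. \<pi> $ v) \<le> (\<Sum>v\<in>S. \<pi> $ v * (\<Sum>u\<in>-S. P $ v $ u) powr p)"
proof -
  have "0 < (\<Sum>v\<in>S. \<pi> $ v)" using assms \<pi>_pos by (intro sum_pos) auto
  moreover have "phi p P \<pi> \<le> (\<Sum>v\<in>S. \<pi> $ v * (\<Sum>u\<in>-S. P $ v $ u) powr p) / (\<Sum>v\<in>S. \<pi> $ v)"
    unfolding phi_def using assms by (intro Min_le) auto
  ultimately show ?thesis by (simp add: pos_le_divide_eq)
qed

text \<open>The set \<open>S\<close> ensures that the minimum is not taken over the empty family,
  where \<open>Min\<close> is unspecified.\<close>

lemma phi_nonneg:
  assumes "S \<noteq> {}" "(\<Sum>v\<in>S. \<pi> $ v) \<le> 1/2"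
  shows "0 \<le> phi p P \<pi>"
  unfolding phi_def using assms
  by (subst Min_ge_iff) (auto intro!: divide_nonneg_nonneg sum_nonneg mult_nonneg_nonneg less_imp_le[OF \<pi>_pos])

lemma exit_prob_bounds: "0 \<le> (\<Sum>u\<in>S. P $ v $ u)" "(\<Sum>u\<in>S. P $ v $ u) \<le> 1"
proof -
  show "0 \<le> (\<Sum>u\<in>S. P $ v $ u)" by (simp add: sum_nonneg P_nonneg)
  show "(\<Sum>u\<in>S. P $ v $ u) \<le> 1"
    unfolding row_sum[of v, symmetric] by (intro sum_mono2) (auto simp: P_nonneg)
qed

text \<open>Covers large eigenvalues, for which the scale \<open>c\<close> would exceed 1 and
  \<open>phi_level_sets\<close> does not apply.\<close>

lemma phi_le_1:
  assumes "S \<noteq> {}" "(\<Sum>v\<in>S. \<pi> $ v) \<le> 1/2" "0 \<le> p"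
  shows "phi p P \<pi> \<le> 1"
proof -
  have "\<pi> $ v * (\<Sum>u\<in>-S. P $ v $ u) powr p \<le> \<pi> $ v" for v
    using powr_mono2[of p "\<Sum>u\<in>-S. P $ v $ u" 1] exit_prob_bounds[of v "-S"] assms(3) \<pi>_pos[of v]
    by (simp add: mult_left_le)
  then have "(\<Sum>v\<in>S. \<pi> $ v * (\<Sum>u\<in>-S. P $ v $ u) powr p) \<le> (\<Sum>v\<in>S. \<pi> $ v)"
    by (intro sum_mono)
  then have "phi p P \<pi> * (\<Sum>v\<in>S. \<pi> $ v) \<le> 1 * (\<Sum>v\<in>S. \<pi> $ v)"
    using phi_mult_le[OF assms(1,2), of p] by simp
  moreover have "0 < (\<Sum>v\<in>S. \<pi> $ v)" using assms \<pi>_pos by (intro sum_pos) auto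
  ultimately show ?thesis by (simp only: mult_le_cancel_right_pos)
qed

lemma phi_level_sets:
  assumes p: "1/2 < p" "p \<le> 1" and c: "0 < c" "c \<le> 1"
    and g: "\<And>v. 0 \<le> g $ v" and half: "(\<Sum>v | 0 < g $ v. \<pi> $ v) \<le> 1/2"
  shows "phi p P \<pi> * ip g g \<le> p / c * ip g (L *v g) + c * p / (2 * p - 1) * ip g g"
proof -
  \<comment> \<open>A common upper end of the levels, so that one interval serves all
    vertices.\<close>
  define M where "M = Max (range (($) g))"
  have gM: "g $ v \<le> M" for v by (simp add: M_def)
  define D where "D v s = (if s < g $ v then 2 * g $ v * dual_profile p ((g $ v - s) / (c * g $ v)) else 0)" for v s
  have "\<forall>v. \<exists>I. (D v has_integral I) {0..M} \<and> I \<le> (g $ v)\<^sup>2 * (c * p / (2 * p - 1))"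
    unfolding D_def using has_integral_dual_profile[OF p c g gM] by blast
  then obtain I where I: "\<And>v. (D v has_integral I v) {0..M}"
    and I_le: "\<And>v. I v \<le> (g $ v)\<^sup>2 * (c * p / (2 * p - 1))" by metis
  define E where "E v u s = (if g $ u \<le> s \<and> s < g $ v then 2 * (g $ v - s) else 0)" for v u s
  have "((\<lambda>s. phi p P \<pi> * (\<Sum>v\<in>UNIV. \<pi> $ v * (if s < g $ v then 2 * s else 0)))
      has_integral phi p P \<pi> * (\<Sum>v\<in>UNIV. \<pi> $ v * (g $ v)\<^sup>2)) {0..M}"
    by (intro has_integral_mult_right has_integral_sum has_integral_level_weight g gM) simp
  moreover have "((\<lambda>s. \<Sum>v\<in>UNIV. \<pi> $ v * (p / c * (\<Sum>u\<in>UNIV. P $ v $ u * E v u s) + D v s))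
      has_integral (\<Sum>v\<in>UNIV. \<pi> $ v * (p / c * (\<Sum>u\<in>UNIV. P $ v $ u * (max 0 (g $ v - g $ u))\<^sup>2) + I v))) {0..M}"
    unfolding E_def
    by (intro has_integral_mult_right has_integral_sum has_integral_add has_integral_gap g gM I) simp_all
  moreover have "phi p P \<pi> * (\<Sum>v\<in>UNIV. \<pi> $ v * (if s < g $ v then 2 * s else 0))
      \<le> (\<Sum>v\<in>UNIV. \<pi> $ v * (p / c * (\<Sum>u\<in>UNIV. P $ v $ u * E v u s) + D v s))" (is "?l \<le> ?r")
    if "s \<in> {0..M}" for s
  proof -
    have "0 \<le> s" using that by simp
    define S where "S = {v. s < g $ v}"
    define h where "h v = (\<Sum>u\<in>-S. P $ v $ u)" for v
    have pt: "2 * s * h v powr p \<le> p / c * (\<Sum>u\<in>UNIV. P $ v $ u * E v u s) + D v s" if "v \<in> S" for v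
    proof -
      have v: "s < g $ v" "0 < g $ v" using that \<open>0 \<le> s\<close> by (auto simp: S_def)
      \<comment> \<open>For \<open>v\<close> in \<open>S\<close>, the term \<open>E v u s\<close>
        survives only when \<open>u\<close> lies outside \<open>S\<close>.\<close>
      have "(\<Sum>u\<in>UNIV. P $ v $ u * E v u s) = (\<Sum>u\<in>-S. P $ v $ u * (2 * (g $ v - s)))"
        using v by (intro sum.mono_neutral_cong_right) (auto simp: E_def S_def)
      then have E: "(\<Sum>u\<in>UNIV. P $ v $ u * E v u s) = 2 * (g $ v - s) * h v"
        by (simp add: h_def sum_distrib_right[symmetric] mult.commute)
      \<comment> \<open>Enlarging \<open>s\<close> to \<open>g $ v\<close> makes the linear part of
        the profile inequality equal to \<open>p / c\<close> times the energy integrand.\<close>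
      have "2 * s * h v powr p \<le> 2 * g $ v * h v powr p"
        using v by (intro mult_right_mono) auto
      also have "\<dots> \<le> 2 * g $ v * (p * ((g $ v - s) / (c * g $ v)) * h v + dual_profile p ((g $ v - s) / (c * g $ v)))"
        using v p c exit_prob_bounds[of v "-S"] unfolding h_def
        by (intro mult_left_mono powr_le_dual_profile) auto
      also have "\<dots> = p / c * (2 * (g $ v - s) * h v) + D v s"
        using v c by (simp add: D_def field_simps)
      finally show ?thesis by (simp add: E)
    qed
    have "?l = 2 * s * (phi p P \<pi> * (\<Sum>v\<in>S. \<pi> $ v))"
    proof -
      have "(\<Sum>v\<in>UNIV. \<pi> $ v * (if s < g $ v then 2 * s else 0)) = (\<Sum>v\<in>S. \<pi> $ v * (2 * s))"
        by (intro sum.mono_neutral_cong_right) (auto simp: S_def)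
      then show ?thesis by (simp add: sum_distrib_right[symmetric])
    qed
    also have "\<dots> \<le> 2 * s * (\<Sum>v\<in>S. \<pi> $ v * h v powr p)"
    proof (cases "S = {}")
      case False
      have "(\<Sum>v\<in>S. \<pi> $ v) \<le> (\<Sum>v | 0 < g $ v. \<pi> $ v)"
        using \<open>0 \<le> s\<close> by (intro sum_mono2) (auto simp: S_def less_imp_le[OF \<pi>_pos])
      then show ?thesis
        using phi_mult_le[OF False, of p] half \<open>0 \<le> s\<close> unfolding h_def by (intro mult_left_mono) auto
    qed simp
    also have "\<dots> = (\<Sum>v\<in>S. \<pi> $ v * (2 * s * h v powr p))"
      by (simp add: sum_distrib_left mult_ac)
    also have "\<dots> \<le> (\<Sum>v\<in>S. \<pi> $ v * (p / c * (\<Sum>u\<in>UNIV. P $ v $ u * E v u s) + D v s))"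
      using pt by (intro sum_mono mult_left_mono) (auto simp: less_imp_le[OF \<pi>_pos])
    \<comment> \<open>At vertices outside \<open>S\<close> both \<open>D\<close> and
      \<open>E\<close> vanish.\<close>
    also have "\<dots> = ?r"
      by (intro sum.mono_neutral_left) (auto simp: S_def D_def E_def)
    finally show ?thesis .
  qed
  ultimately have "phi p P \<pi> * (\<Sum>v\<in>UNIV. \<pi> $ v * (g $ v)\<^sup>2)
      \<le> (\<Sum>v\<in>UNIV. \<pi> $ v * (p / c * (\<Sum>u\<in>UNIV. P $ v $ u * (max 0 (g $ v - g $ u))\<^sup>2) + I v))"
    by (rule has_integral_le)
  also have "\<dots> \<le> (\<Sum>v\<in>UNIV. \<pi> $ v * (p / c * (\<Sum>u\<in>UNIV. P $ v $ u * (max 0 (g $ v - g $ u))\<^sup>2)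
      + (g $ v)\<^sup>2 * (c * p / (2 * p - 1))))"
    using I_le by (intro sum_mono mult_left_mono add_left_mono) (auto simp: less_imp_le[OF \<pi>_pos])
  also have "\<dots> = p / c * ip g (L *v g) + c * p / (2 * p - 1) * ip g g"
    unfolding energy
    by (simp add: ip_def distrib_left sum.distrib sum_distrib_left power2_eq_square mult_ac)
  finally show ?thesis by (simp add: ip_def power2_eq_square)
qed

section \<open>From the eigenvector to the bound\<close>

lemma positive_part_energy:
  assumes "L *v f = \<mu> *\<^sub>R f"
  defines "g \<equiv> \<chi> v. max 0 (f $ v)"
  shows "ip g (L *v g) \<le> \<mu> * ip g g"
proof -
  have "g $ v * (L *v g) $ v \<le> \<mu> * (g $ v * g $ v)" for v
  proof (cases "0 < f $ v")
    case True
    then have gv: "g $ v = f $ v" by (simp add: g_def)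
    \<comment> \<open>\<open>g\<close> agrees with \<open>f\<close> at \<open>v\<close> and is at
      least \<open>f\<close> elsewhere, so no difference along an edge leaving \<open>v\<close>
      increases.\<close>
    have "(L *v g) $ v \<le> (L *v f) $ v"
      unfolding L_nth gv by (intro sum_mono mult_left_mono P_nonneg) (simp add: g_def)
    then have "(L *v g) $ v \<le> \<mu> * g $ v" using assms(1) gv by simp
    then show ?thesis using mult_left_mono[of "(L *v g) $ v" "\<mu> * g $ v" "g $ v"] True gv
      by (simp add: mult_ac)
  qed (simp add: g_def)
  then show ?thesis
    unfolding ip_def sum_distrib_left mult.left_commute[of \<mu>]
    by (intro sum_mono mult_left_mono[where c = "\<pi> $ _"] less_imp_le[OF \<pi>_pos])
      (simp add: mult_ac)
qed

lemma ex_pos_if_mean_0: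
  assumes "ip 1 f = 0" "f \<noteq> 0"
  shows "\<exists>v. 0 < f $ v"
proof (rule ccontr)
  assume "\<nexists>v. 0 < f $ v"
  then have le: "f $ v \<le> 0" for v by (simp add: not_less)
  have "(\<Sum>v\<in>UNIV. \<pi> $ v * - f $ v) = 0" using assms(1) by (simp add: ip_def sum_negf)
  then have "\<forall>v. \<pi> $ v * - f $ v = 0"
    using le by (subst (asm) sum_nonneg_eq_0_iff) (auto simp: mult_le_0_iff less_imp_le[OF \<pi>_pos])
  then have "f $ v = 0" for v using \<pi>_pos[of v] by (metis less_irrefl mult_eq_0_iff neg_equal_0_iff_equal)
  then show False using assms(2) by (simp add: vec_eq_iff)
qed

text \<open>Orthogonality to constants makes both \<open>f\<close> and \<open>- f\<close> positive
  somewhere. Their positive supports are disjoint, so one of them has measure at most 1/2.\<close>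

lemma eigenvector_small_support:
  assumes "f \<noteq> 0" "L *v f = \<mu> *\<^sub>R f" "\<mu> \<noteq> 0"
  shows "\<exists>f. L *v f = \<mu> *\<^sub>R f \<and> {v. 0 < f $ v} \<noteq> {} \<and> (\<Sum>v | 0 < f $ v. \<pi> $ v) \<le> 1/2"
proof -
  have "\<mu> * ip 1 f = 0" using ip_one_L[of f] assms(2) by (simp add: ip_simps)
  then have mean: "ip 1 f = 0" using assms(3) by simp
  have "ip 1 (- f) = 0" using mean by (simp add: ip_def sum_negf)
  then have ne: "{v. 0 < f $ v} \<noteq> {}" "{v. 0 < (- f) $ v} \<noteq> {}"
    using ex_pos_if_mean_0[of f] ex_pos_if_mean_0[of "- f"] mean assms(1) by auto
  have neg: "L *v (- f) = \<mu> *\<^sub>R (- f)"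
    using assms(2) by (simp add: vec.neg)
  have "(\<Sum>v | 0 < f $ v. \<pi> $ v) + (\<Sum>v | 0 < (- f) $ v. \<pi> $ v)
      = (\<Sum>v\<in>{v. 0 < f $ v} \<union> {v. 0 < (- f) $ v}. \<pi> $ v)"
    by (rule sum.union_disjoint[symmetric]) auto
  also have "\<dots> \<le> 1"
    unfolding \<pi>_sum[symmetric] by (intro sum_mono2) (auto simp: less_imp_le[OF \<pi>_pos])
  finally consider "(\<Sum>v | 0 < f $ v. \<pi> $ v) \<le> 1/2" | "(\<Sum>v | 0 < (- f) $ v. \<pi> $ v) \<le> 1/2"
    by linarith
  then show ?thesis
  proof cases
    case 1 then show ?thesis using ne(1) assms(2) by blast
  next
    case 2 then show ?thesis using ne(2) neg by blast
  qed
qed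

lemma phi_squared_le_eigenvalue:
  assumes p: "1/2 < p" "p \<le> 1" and f: "f \<noteq> 0" "L *v f = \<mu> *\<^sub>R f" and \<mu>: "0 < \<mu>"
  shows "(phi p P \<pi>)\<^sup>2 \<le> 4 / (2 * p - 1) * \<mu>"
proof -
  obtain f where f: "L *v f = \<mu> *\<^sub>R f" and ne: "{v. 0 < f $ v} \<noteq> {}"
    and half: "(\<Sum>v | 0 < f $ v. \<pi> $ v) \<le> 1/2"
    using eigenvector_small_support[OF f] \<mu> by auto
  have nonneg: "0 \<le> phi p P \<pi>" using phi_nonneg[OF ne half] .
  \<comment> \<open>This value balances the two terms \<open>p / c * \<mu>\<close> and
    \<open>c * p / (2 * p - 1)\<close>.\<close>
  define c where "c = sqrt ((2 * p - 1) * \<mu>)"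
  have c: "0 < c" "c\<^sup>2 = (2 * p - 1) * \<mu>" using p \<mu> by (simp_all add: c_def)
  have "phi p P \<pi> \<le> 2 * c / (2 * p - 1)"
  proof (cases "c \<le> 1")
    case True
    define g :: "real^'v" where "g = (\<chi> v. max 0 (f $ v))"
    obtain v where "0 < f $ v" using ne by blast
    then have "g $ v \<noteq> 0" by (simp add: g_def)
    then have "g \<noteq> 0" by auto
    then have pos: "0 < ip g g" using ip_nonneg[of g] ip_eq_0_iff[of g] by linarith
    have "{v. 0 < g $ v} = {v. 0 < f $ v}" by (auto simp: g_def max_def)
    then have "phi p P \<pi> * ip g g \<le> p / c * ip g (L *v g) + c * p / (2 * p - 1) * ip g g"
      using phi_level_sets[OF p c(1) True, of g] half by (simp add: g_def)
    also have "\<dots> \<le> p / c * (\<mu> * ip g g) + c * p / (2 * p - 1) * ip g g"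
      using positive_part_energy[OF f] p c unfolding g_def
      by (intro add_right_mono mult_left_mono) auto
    also have "\<dots> = (p / c * \<mu> + c * p / (2 * p - 1)) * ip g g" by (simp add: algebra_simps)
    also have "\<mu> = c\<^sup>2 / (2 * p - 1)" using c(2) p by simp
    also have "p / c * (c\<^sup>2 / (2 * p - 1)) = c * p / (2 * p - 1)"
      using c(1) by (simp add: power2_eq_square)
    also have "c * p / (2 * p - 1) + c * p / (2 * p - 1) = p * (2 * c / (2 * p - 1))"
      by simp
    finally have "phi p P \<pi> \<le> p * (2 * c / (2 * p - 1))"
      using pos by (simp only: mult_le_cancel_right_pos)
    \<comment> \<open>The factor \<open>p \<le> 1\<close> is given up here, which leaves the
      constant 4 after squaring.\<close>
    also have "\<dots> \<le> 2 * c / (2 * p - 1)"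
      using p c by (intro mult_left_le_one_le) auto
    finally show ?thesis .
  next
    case False
    have "phi p P \<pi> \<le> 1" using phi_le_1[OF ne half] p by simp
    also have "1 \<le> 2 * c / (2 * p - 1)" using False p by (simp add: field_simps)
    finally show ?thesis .
  qed
  then have "(phi p P \<pi>)\<^sup>2 \<le> (2 * c / (2 * p - 1))\<^sup>2"
    using nonneg by (intro power_mono)
  also have "\<dots> = 4 / (2 * p - 1) * \<mu>"
    using p unfolding power_divide power_mult_distrib c(2) by (simp add: power2_eq_square)
  finally show ?thesis .
qed

end

theorem theorem1p5:
  fixes P :: "real^'v^'v::finite" and \<pi> :: "real^'v" and p :: real
  assumes "CARD('v) \<ge> 2"
    and "markov_chain P \<pi>"
    and "irreducible_chain P"
    and "reversible_chain P \<pi>"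
    and "1/2 < p" and "p \<le> 1"
  shows "(phi p P \<pi>)\<^sup>2 \<le> 4 / (2 * p - 1) * lambda2 (mat 1 - P)"
proof -
  interpret reversible_markov P \<pi>
    using assms by unfold_locales
  show ?thesis
    using lambda2_eigenvector[OF assms(1)] phi_squared_le_eigenvalue[OF assms(5,6)]
    unfolding L_def by blast
qed

end
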